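(* Let $X$ and $Y$ be compact Hausdorff spaces, and let $E$ and $F$ be real or complex normed spaces, not necessarily complete, such that $F$ satisfies property $(D_w)$. Let $A$ and $B$ be subspaces of $C(X,E)$ and $C(Y,F)$, respectively, containing the constant functions, such that $A$ is completely regular and $B$ is $F$-separating. Let $\|\cdot\|_A$ and $\|\cdot\|_B$ be norms on $A$ and $B$, respectively, of the form \[ \|\cdot\|_A=\max(\|\cdot\|_\infty,p(\cdot))\quad\text{and}\quad \|\cdot\|_B=\max(\|\cdot\|_\infty,q(\cdot))\] for some seminorms $p$ and $q$ on $A$ and $B$, respectively, whose kernels contain the constant functions. Then for any surjective real-linear isometry $T:(A,\|\cdot\|_A)\to (B,\|\cdot\|_B)$ such that $T$ and $T^{-1}$ satisfy (St), there exist a surjective continuous map $\varphi: Y\to X$ and a family $\{V_y\}_{y\in Y}$ of bounded real-linear operators from $E$ to $F$ with $\|V_y\|\le 1$ such that for each $y\in Y$ \[ Tf(y)=V_y(f(\varphi(y)))\qquad (f\in A).\] Moreover, if $E$ also satisfies property $(D_w)$ and $B$ is completely regular, then $\varphi$ is a homeomorphism and each $V_y$ is a surjective isometry.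
   Context: For a compact Hausdorff space $X$ and a normed space $E$, $C(X,E)$ is the space of all continuous $E$-valued functions on $X$, and $\|\cdot\|_\infty$ is the supremum norm. For $v\in E$, $\hat v$ denotes the constant function $x\mapsto v$. $S(E)$ is the unit sphere of $E$. A subset $S$ of a normed space $E$ is norm additive if $\|e_1+\cdots+e_n\|=\|e_1\|+\cdots+\|e_n\|$ for every finite collection $e_1,\dots,e_n$ of elements of $S$. A $T$-set in $E$ is a maximal (with respect to inclusion) norm additive subset of $E$. Property $(D_w)$: a normed space $E$ satisfies property $(D_w)$ if there exists a $T$-set $R_0$ in $E$ such that for every $T$-set $R$ in $E$ distinct from $R_0$, either $R_0\cap R=\{0\}$ or there exists a $T$-set $L$ in $E$ with $R_0\cap L=R\cap L=\{0\}$. A subspace $A$ of $C(X,E)$ is $E$-separating if for any distinct points $x_1\neq x_2$ in $X$ and any $u\in E$ there exists $f\in A$ with $f(x_1)=u$, $\|f\|_\infty=\|u\|$ and $f(x_2)=0$. (Likewise $F$-separating for subspaces of $C(Y,F)$.) A subspace $A$ of $C(X,E)$ is completely regular if for any $x\in X$, any $u\in E$ and any neighbourhood $U$ of $x$ there exists $f\in A$ with $f(x)=u$, $\|f\|_\infty=\|u\|$ and $f=0$ on $X\setminus U$. Property (St) for a surjective real-linear isometry $T:(A,\|\cdot\|_A)\to(B,\|\cdot\|_B)$: for each $u\in F$ and $y_0\in Y$ there exists $v\in S(E)$ such that $\|T\hat v(y_0)+u\|>\|u\|$. Correspondingly, $T^{-1}$ satisfies (St) if for each $u\in E$ and $x_0\in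 X$ there exists $v\in S(F)$ such that $\|T^{-1}\hat v(x_0)+u\|>\|u\|$. *)

theory Defs
  imports "HOL-Analysis.Analysis"
begin

text \<open>
  The type \<^typ>\<open>'x \<Rightarrow>\<^sub>C 'e\<close> consists of the bounded continuous functions with
  the supremum norm; when \<^term>\<open>compact (UNIV :: 'x::topological_space set)\<close> it is the space of all continuous functions.

  All normed spaces are real ones.  A complex normed space and its complex subspaces, norms and
  seminorms are in particular real ones, and every notion below as well as real-linearity of
  operators involves only the additive structure, real scalars and the norm.
\<close>

definition norm_additive :: "'e::real_normed_vector set \<Rightarrow> bool" where
  "norm_additive S \<longleftrightarrow>
     (\<forall>es. set es \<subseteq> S \<longrightarrow> norm (sum_list es) = sum_list (map norm es))"

definition T_set :: "'e::real_normed_vector set \<Rightarrow> bool" where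
  "T_set R \<longleftrightarrow> norm_additive R \<and> (\<forall>S. norm_additive S \<and> R \<subseteq> S \<longrightarrow> S = R)"

definition property_Dw :: "'e::real_normed_vector itself \<Rightarrow> bool" where
  "property_Dw _ \<longleftrightarrow>
     (\<exists>R0::'e set. T_set R0 \<and>
        (\<forall>R. T_set R \<and> R \<noteq> R0 \<longrightarrow>
           R0 \<inter> R = {0} \<or> (\<exists>L. T_set L \<and> R0 \<inter> L = {0} \<and> R \<inter> L = {0})))"

definition separating :: "('x::topological_space \<Rightarrow>\<^sub>C 'e::real_normed_vector) set \<Rightarrow> bool" where
  "separating A \<longleftrightarrow>
     (\<forall>x1 x2 u. x1 \<noteq> x2 \<longrightarrow>
        (\<exists>f\<in>A. apply_bcontfun f x1 = u \<and> norm f = norm u \<and> apply_bcontfun f x2 = 0))"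

definition completely_regular ::
    "('x::topological_space \<Rightarrow>\<^sub>C 'e::real_normed_vector) set \<Rightarrow> bool" where
  "completely_regular A \<longleftrightarrow>
     (\<forall>x u U. x \<in> interior U \<longrightarrow>
        (\<exists>f\<in>A. apply_bcontfun f x = u \<and> norm f = norm u \<and> (\<forall>z. z \<notin> U \<longrightarrow> apply_bcontfun f z = 0)))"

definition seminorm_on :: "'v::real_vector set \<Rightarrow> ('v \<Rightarrow> real) \<Rightarrow> bool" where
  "seminorm_on A p \<longleftrightarrow>
     (\<forall>f\<in>A. 0 \<le> p f) \<and>
     (\<forall>f\<in>A. \<forall>g\<in>A. p (f + g) \<le> p f + p g) \<and>
     (\<forall>c. \<forall>f\<in>A. p (c *\<^sub>R f) = \<bar>c\<bar> * p f)"

text \<open>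
  A surjective real-linear isometry between the subspaces \<open>A\<close> and \<open>B\<close> normed by \<open>nA\<close> and \<open>nB\<close>;
  the values of \<open>T\<close> outside \<open>A\<close> are irrelevant, and its inverse is \<^term>\<open>inv_into A T\<close>.
\<close>

definition surj_linear_isometry ::
    "'v::real_vector set \<Rightarrow> ('v \<Rightarrow> real) \<Rightarrow> 'w::real_vector set \<Rightarrow> ('w \<Rightarrow> real) \<Rightarrow> ('v \<Rightarrow> 'w) \<Rightarrow> bool" where
  "surj_linear_isometry A nA B nB T \<longleftrightarrow>
     T ` A = B \<and>
     (\<forall>f\<in>A. \<forall>g\<in>A. T (f + g) = T f + T g) \<and>
     (\<forall>c. \<forall>f\<in>A. T (c *\<^sub>R f) = c *\<^sub>R T f) \<and>
     (\<forall>f\<in>A. nB (T f) = nA f)"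

definition property_St ::
    "(('x::topological_space \<Rightarrow>\<^sub>C 'e::real_normed_vector) \<Rightarrow>
      ('y::topological_space \<Rightarrow>\<^sub>C 'f::real_normed_vector)) \<Rightarrow> bool" where
  "property_St T \<longleftrightarrow>
     (\<forall>u y0. \<exists>v\<in>sphere 0 1. norm (apply_bcontfun (T (const_bcontfun v)) y0 + u) > norm u)"

end

theory Submission
  imports Defs
begin

text \<open>
  The isometry is first shown to preserve the supremum norm, and then analysed through norm
  additive sets, a purely metric notion that such an isometry respects.

  The norms \<open>max (norm f) (p f)\<close> and \<open>max (norm g) (q g)\<close> differ from the supremum norm only where the
  seminorm dominates.  Where \<open>p\<close> strictly dominates at \<open>f\<close>, small constants can be added to \<open>f\<close>
  without increasing its norm; property (St) forbids this when the norm of \<open>T f\<close> is its supremum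
  norm, which is attained at a point.  Hence \<open>T\<close> respects the elements at which the norm is the supremum norm, and adding to
  \<open>T f\<close> a large constant pointing in the direction of a value of maximal norm brings every function
  into this class (\<open>norm_isometry_le\<close>).

  For a sup-norm isometry \<open>T\<close> with inverse \<open>S\<close>, consider the sets \<open>peak B y Q\<close> of the functions
  that attain their norm at \<open>y\<close> with a value in the T-set \<open>Q\<close>.  They are norm additive, and by
  compactness every norm additive set of functions lies in one of them (\<open>norm_additive_imp_peak\<close>).
  Since \<open>B\<close> is separating they are maximal, so each of them is the image of a peak set
  \<open>peak A x R\<close> (\<open>peak_is_image\<close>).  Functions on \<open>X\<close> can peak at two different points
  simultaneously with prescribed directions, whereas no nonzero function peaks at \<open>y\<close> in two T-sets
  that meet only in \<open>0\<close>; together with property \<open>(D\<^sub>w)\<close> this makes the point \<open>x\<close> depend on \<open>y\<close>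
  only (\<open>common_peak_point\<close>), which defines \<open>\<phi> y = x\<close>.

  If \<open>f\<close> vanishes at \<open>\<phi> y\<close>, a narrow bump \<open>h\<close> at \<open>\<phi> y\<close> as large as \<open>f\<close> barely interacts with \<open>f\<close> in
  norm, while it can be chosen such that the norms of \<open>T f y\<close> and \<open>T h y\<close> add up; this forces \<open>T f y = 0\<close>
  (\<open>image_vanishes\<close>).  So \<open>T f y\<close> depends on \<open>f (\<phi> y)\<close> only, through the map
  \<open>V\<^sub>y e = T e^ y\<close>, where \<open>e^\<close> is the constant function with value \<open>e\<close>.  Applying all this to \<open>S\<close> as
  well yields the inverse of \<open>\<phi>\<close>, and contractive inverses of the \<open>V\<^sub>y\<close>.
\<close>

section \<open>Norm additive sets and T-sets\<close>

lemma norm_sum_list_le: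
  fixes us :: "'e::real_normed_vector list"
  shows "norm (sum_list us) \<le> sum_list (map norm us)"
  by (induction us) (auto intro: norm_triangle_le)

lemma norm_additive_pair:
  assumes "norm_additive R" "u \<in> R" "w \<in> R"
  shows "norm (u + w) = norm u + norm w"
proof -
  have "norm (sum_list [u, w]) = sum_list (map norm [u, w])"
    using assms(1)[unfolded norm_additive_def, rule_format, of "[u, w]"] assms(2,3) by simp
  then show ?thesis
    by simp
qed

lemma norm_additive_imp_T_set:
  fixes N :: "'e::real_normed_vector set"
  assumes "norm_additive N"
  shows "\<exists>R. T_set R \<and> N \<subseteq> R"
proof -
  let ?\<A> = "{R. norm_additive R \<and> N \<subseteq> R}"
  have "\<exists>M\<in>?\<A>. \<forall>X\<in>?\<A>. M \<subseteq> X \<longrightarrow> X = M"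
  proof (rule subset_Zorn_nonempty)
    show "?\<A> \<noteq> {}"
      using assms by auto
  next
    fix \<C> assume ne: "\<C> \<noteq> {}" and ch: "subset.chain ?\<A> \<C>"
    have "norm (sum_list es) = sum_list (map norm es)" if es: "set es \<subseteq> \<Union>\<C>" for es
    proof -
      have "\<exists>C\<in>\<C>. set es \<subseteq> C"
        by (rule finite_subset_Union_chain[OF finite_set es ne ch]) auto
      then show ?thesis
        using ch unfolding subset.chain_def norm_additive_def by blast
    qed
    moreover have "N \<subseteq> \<Union>\<C>"
      using ne ch unfolding subset.chain_def by blast
    ultimately show "\<Union>\<C> \<in> ?\<A>"
      unfolding norm_additive_def by auto
  qed
  then obtain M where M: "norm_additive M" "N \<subseteq> M"
    "\<And>X. norm_additive X \<Longrightarrow> N \<subseteq> X \<Longrightarrow> M \<subseteq> X \<Longrightarrow> X = M"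
    by auto
  then have "T_set M"
    unfolding T_set_def by blast
  then show ?thesis
    using M by blast
qed

text \<open>
  Enlarging the coefficients to a common bound \<open>M\<close> costs at most \<open>M - c\<close> times the norm of each
  summand, so equality for the coefficient \<open>M\<close> leaves no room for a strict triangle inequality.
\<close>
lemma norm_additive_cone:
  fixes N :: "'e::real_normed_vector set"
  assumes "norm_additive N"
  shows "norm_additive {c *\<^sub>R u |c u. 0 \<le> c \<and> u \<in> N}"
  unfolding norm_additive_def
proof (intro allI impI)
  fix es :: "'e list" assume "set es \<subseteq> {c *\<^sub>R u |c u. 0 \<le> c \<and> u \<in> N}"
  then have "\<exists>ps. es = map (\<lambda>(c, u). c *\<^sub>R u) ps \<and> (\<forall>(c, u)\<in>set ps. 0 \<le> c \<and> u \<in> N)"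
  proof (induction es)
    case Nil
    then show ?case by simp
  next
    case (Cons e es)
    then obtain ps c u where "es = map (\<lambda>(c, u). c *\<^sub>R u) ps"
      "\<forall>(c, u)\<in>set ps. 0 \<le> c \<and> u \<in> N" "e = c *\<^sub>R u" "0 \<le> c" "u \<in> N"
      by auto
    then show ?case
      by (intro exI[of _ "(c, u) # ps"]) auto
  qed
  then obtain ps where es: "es = map (\<lambda>(c, u). c *\<^sub>R u) ps"
    and ps: "\<forall>(c, u)\<in>set ps. 0 \<le> c \<and> u \<in> N"
    by blast
  define M where "M = sum_list (map fst ps)"
  have M: "c \<le> M" if "(c, u) \<in> set ps" for c u
    unfolding M_def using ps that
    by (intro member_le_sum_list) (auto simp: image_iff intro: bexI[of _ "(c, u)"])
  have M0: "0 \<le> M"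
    unfolding M_def using ps by (intro sum_list_nonneg) auto
  define us where "us = map snd ps"
  have "set us \<subseteq> N"
    using ps unfolding us_def by auto
  then have "norm (sum_list us) = sum_list (map norm us)"
    using assms unfolding norm_additive_def by blast
  moreover have "M *\<^sub>R sum_list us = sum_list es + sum_list (map (\<lambda>(c, u). (M - c) *\<^sub>R u) ps)"
    unfolding us_def es by (induction ps) (auto simp: algebra_simps)
  moreover have "norm (sum_list (map (\<lambda>(c, u). (M - c) *\<^sub>R u) ps))
      \<le> sum_list (map (\<lambda>(c, u). (M - c) * norm u) ps)"
  proof -
    have "map norm (map (\<lambda>(c, u). (M - c) *\<^sub>R u) ps) = map (\<lambda>(c, u). (M - c) * norm u) ps"
      using M by auto
    then show ?thesis
      using norm_sum_list_le[of "map (\<lambda>(c, u). (M - c) *\<^sub>R u) ps"] by (simp only:)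
  qed
  moreover have "M * sum_list (map norm us)
      = sum_list (map norm es) + sum_list (map (\<lambda>(c, u). (M - c) * norm u) ps)"
    unfolding us_def es using ps by (induction ps) (auto simp: algebra_simps)
  moreover have "norm (M *\<^sub>R sum_list us) = M * norm (sum_list us)"
    using M0 by simp
  ultimately have "sum_list (map norm es) \<le> norm (sum_list es)"
    using norm_triangle_ineq[of "sum_list es" "sum_list (map (\<lambda>(c, u). (M - c) *\<^sub>R u) ps)"]
    by simp
  then show "norm (sum_list es) = sum_list (map norm es)"
    using norm_sum_list_le[of es] by simp
qed

lemma norm_additive_singleton: "norm_additive {u}"
proof -
  have "sum_list es = real (length es) *\<^sub>R u \<and> sum_list (map norm es) = real (length es) * norm u"
    if "set es \<subseteq> {u}" for es
    using that by (induction es) (auto simp: algebra_simps)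
  then show ?thesis
    unfolding norm_additive_def by simp
qed

lemma T_set_scaleR:
  assumes "T_set R" "u \<in> R" "0 \<le> c"
  shows "c *\<^sub>R u \<in> R"
proof -
  let ?N = "{c *\<^sub>R u |c u. 0 \<le> c \<and> u \<in> R}"
  have "R \<subseteq> ?N"
    by (force intro: exI[of _ 1])
  then have "?N = R"
    using assms norm_additive_cone unfolding T_set_def by blast
  then show ?thesis
    using assms by blast
qed

lemma T_set_containing: "\<exists>R. T_set R \<and> u \<in> R"
  using norm_additive_imp_T_set[OF norm_additive_singleton[of u]] by auto

text \<open>T-sets are cones, and \<open>{0}\<close> is not maximal when there is a nonzero vector.\<close>
lemma T_set_has_vector_of_norm:
  fixes R :: "'e::real_normed_vector set"
  assumes R: "T_set R" and nontrivial: "\<exists>u::'e. u \<noteq> 0" and s: "0 \<le> s"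
  shows "\<exists>u\<in>R. norm u = s"
proof -
  obtain w where w: "w \<in> R" "w \<noteq> 0"
  proof -
    obtain u :: 'e where u: "u \<noteq> 0"
      using nontrivial by blast
    obtain Q where Q: "T_set Q" "u \<in> Q"
      using T_set_containing by blast
    have "0 \<in> Q"
      using T_set_scaleR[OF Q, of 0] by simp
    then have "\<not> R \<subseteq> {0}"
      using R Q u unfolding T_set_def by (metis empty_iff insert_subset subset_iff singleton_iff)
    then show ?thesis
      using that by auto
  qed
  have "(s / norm w) *\<^sub>R w \<in> R"
    using T_set_scaleR[OF R w(1)] s by simp
  then show ?thesis
    using w s by (intro bexI[of _ "(s / norm w) *\<^sub>R w"]) auto
qed

section \<open>Functions that peak at a point\<close>

lemma bcontfun_norm_attained:
  fixes f :: "'x::topological_space \<Rightarrow>\<^sub>C 'e::real_normed_vector"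
  assumes "compact (UNIV :: 'x set)"
  shows "\<exists>x. norm (f x) = norm f"
proof -
  have "\<exists>x\<in>UNIV. \<forall>z\<in>UNIV. norm (f z) \<le> norm (f x)"
    using assms by (intro continuous_attains_sup continuous_on_norm) auto
  then obtain x where "\<And>z. norm (f z) \<le> norm (f x)"
    by auto
  then have "norm f = norm (f x)"
    by (intro antisym norm_bound norm_bounded)
  then show ?thesis
    by metis
qed

lemma norm_const_bcontfun [simp]:
  "norm (const_bcontfun v :: 'x::topological_space \<Rightarrow>\<^sub>C 'e::real_normed_vector) = norm v"
proof (rule antisym)
  show "norm (const_bcontfun v :: 'x \<Rightarrow>\<^sub>C 'e) \<le> norm v"
    by (rule norm_bound) simp
  show "norm v \<le> norm (const_bcontfun v :: 'x \<Rightarrow>\<^sub>C 'e)"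
    using norm_bounded[of "const_bcontfun v :: 'x \<Rightarrow>\<^sub>C 'e"] by simp
qed

lemma const_bcontfun_add:
  "const_bcontfun (u + v) = const_bcontfun u + (const_bcontfun v :: _ \<Rightarrow>\<^sub>C 'e::real_normed_vector)"
  by (rule bcontfun_eqI) simp

lemma const_bcontfun_scaleR:
  "const_bcontfun (c *\<^sub>R v) = c *\<^sub>R (const_bcontfun v :: _ \<Rightarrow>\<^sub>C 'e::real_normed_vector)"
  by (rule bcontfun_eqI) simp

lemma apply_bcontfun_sum_list:
  fixes fs :: "('x::topological_space \<Rightarrow>\<^sub>C 'e::real_normed_vector) list"
  shows "apply_bcontfun (sum_list fs) x = sum_list (map (\<lambda>f. apply_bcontfun f x) fs)"
  by (induction fs) auto

definition peak ::
    "('x::topological_space \<Rightarrow>\<^sub>C 'e::real_normed_vector) set \<Rightarrow> 'x \<Rightarrow> 'e set \<Rightarrow> ('x \<Rightarrow>\<^sub>C 'e) set" where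
  "peak A x R = {f\<in>A. apply_bcontfun f x \<in> R \<and> norm (apply_bcontfun f x) = norm f}"

lemma norm_additive_peak:
  assumes "norm_additive R"
  shows "norm_additive (peak A x R)"
  unfolding norm_additive_def
proof (intro allI impI)
  fix fs assume fs: "set fs \<subseteq> peak A x R"
  have "sum_list (map norm fs) = sum_list (map norm (map (\<lambda>f. apply_bcontfun f x) fs))"
    using fs unfolding peak_def by (intro arg_cong[of _ _ sum_list]) (auto simp: subset_iff)
  also have "\<dots> = norm (sum_list (map (\<lambda>f. apply_bcontfun f x) fs))"
  proof -
    have "set (map (\<lambda>f. apply_bcontfun f x) fs) \<subseteq> R"
      using fs unfolding peak_def by auto
    then show ?thesis
      using assms unfolding norm_additive_def by metis
  qed
  also have "\<dots> = norm (apply_bcontfun (sum_list fs) x)"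
    by (simp add: apply_bcontfun_sum_list)
  also have "\<dots> \<le> norm (sum_list fs)"
    by (rule norm_bounded)
  finally show "norm (sum_list fs) = sum_list (map norm fs)"
    using norm_sum_list_le[of fs] by simp
qed

text \<open>
  For a finite list of functions, the norm of the sum is attained at some point, and there the whole
  list and each of its parts add up without loss.  Concatenating lists gives the finite intersection
  property, so by compactness one point serves all lists at once.
\<close>
lemma norm_additive_common_point:
  fixes N :: "('x::topological_space \<Rightarrow>\<^sub>C 'e::real_normed_vector) set"
  assumes comp: "compact (UNIV :: 'x set)" and N: "norm_additive N"
  shows "\<exists>x. \<forall>fs. set fs \<subseteq> N \<longrightarrow> norm (apply_bcontfun (sum_list fs) x) = sum_list (map norm fs)"
proof -
  define C where "C fs = {x. norm (apply_bcontfun (sum_list fs) x) = sum_list (map norm fs)}"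
    for fs :: "('x \<Rightarrow>\<^sub>C 'e) list"
  have closed_C: "closed (C fs)" for fs
    unfolding C_def by (intro closed_Collect_eq continuous_on_norm) auto
  have le: "norm (apply_bcontfun (sum_list fs) x) \<le> sum_list (map norm fs)" for fs x
    using norm_bounded norm_sum_list_le order_trans by blast
  have C_append: "C (fs @ gs) \<subseteq> C fs \<inter> C gs" for fs gs
  proof
    fix x assume "x \<in> C (fs @ gs)"
    then have "sum_list (map norm fs) + sum_list (map norm gs)
        \<le> norm (apply_bcontfun (sum_list fs) x) + norm (apply_bcontfun (sum_list gs) x)"
      unfolding C_def using norm_triangle_ineq[of "sum_list fs x" "sum_list gs x"] by simp
    then show "x \<in> C fs \<inter> C gs"
      unfolding C_def using le[of fs x] le[of gs x] by simp
  qed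
  have concat: "\<exists>gs. set gs \<subseteq> N \<and> C gs \<subseteq> \<Inter>(C ` L)"
    if "finite L" "L \<subseteq> {fs. set fs \<subseteq> N}" for L
    using that
  proof (induction L rule: finite_induct)
    case empty
    show ?case
      by (intro exI[of _ "[]"]) simp
  next
    case (insert fs L)
    then obtain gs where "set gs \<subseteq> N" "C gs \<subseteq> \<Inter>(C ` L)"
      by auto
    then show ?case
      using insert.prems C_append[of fs gs] by (intro exI[of _ "fs @ gs"]) auto
  qed
  have C_ne: "C gs \<noteq> {}" if "set gs \<subseteq> N" for gs
    using bcontfun_norm_attained[OF comp, of "sum_list gs"] N that
    unfolding C_def norm_additive_def by auto
  have "UNIV \<inter> \<Inter>(C ` {fs. set fs \<subseteq> N}) \<noteq> {}"
  proof (rule compact_imp_fip[OF comp])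
    show "closed K" if "K \<in> C ` {fs. set fs \<subseteq> N}" for K
      using that closed_C by auto
    show "UNIV \<inter> \<Inter>\<F> \<noteq> {}" if \<F>: "finite \<F>" "\<F> \<subseteq> C ` {fs. set fs \<subseteq> N}" for \<F>
    proof -
      obtain L where "finite L" "L \<subseteq> {fs. set fs \<subseteq> N}" "\<F> = C ` L"
        using finite_subset_image[OF \<F>] by blast
      then obtain gs where gs: "set gs \<subseteq> N" "C gs \<subseteq> \<Inter>\<F>"
        using concat[of L] by metis
      then show ?thesis
        using C_ne[OF gs(1)] by auto
    qed
  qed
  then obtain x where "\<And>fs. set fs \<subseteq> N \<Longrightarrow> x \<in> C fs"
    by auto
  then show ?thesis
    unfolding C_def by auto
qed

lemma norm_additive_imp_peak:
  fixes N :: "('x::topological_space \<Rightarrow>\<^sub>C 'e::real_normed_vector) set"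
  assumes comp: "compact (UNIV :: 'x set)" and N: "norm_additive N" and "N \<subseteq> A"
  shows "\<exists>x R. T_set R \<and> N \<subseteq> peak A x R"
proof -
  obtain x where x: "\<And>fs. set fs \<subseteq> N \<Longrightarrow>
      norm (apply_bcontfun (sum_list fs) x) = sum_list (map norm fs)"
    using norm_additive_common_point[OF comp N] by blast
  have attained: "norm (apply_bcontfun f x) = norm f" if "f \<in> N" for f
    using x[of "[f]"] that by simp
  have "norm_additive ((\<lambda>f. apply_bcontfun f x) ` N)"
    unfolding norm_additive_def
  proof (intro allI impI)
    fix es assume "set es \<subseteq> (\<lambda>f. apply_bcontfun f x) ` N"
    then have "es \<in> lists ((\<lambda>f. apply_bcontfun f x) ` N)"
      by auto
    then obtain fs where fs: "set fs \<subseteq> N" "es = map (\<lambda>f. apply_bcontfun f x) fs"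
      unfolding lists_image by auto
    have "map norm es = map norm fs"
      using fs attained by auto
    then show "norm (sum_list es) = sum_list (map norm es)"
      using x[OF fs(1)] fs(2) by (simp only: apply_bcontfun_sum_list)
  qed
  then obtain R where "T_set R" "(\<lambda>f. apply_bcontfun f x) ` N \<subseteq> R"
    using norm_additive_imp_T_set by blast
  then show ?thesis
    using assms attained unfolding peak_def by blast
qed

text \<open>Functions of \<open>B\<close> vanishing at \<open>y'\<close> separate the points, constant functions the T-sets.\<close>
lemma peak_inclusion_imp_eq:
  fixes B :: "('y::topological_space \<Rightarrow>\<^sub>C 'f::real_normed_vector) set"
  assumes sep: "separating B" and const: "range const_bcontfun \<subseteq> B"
    and nontrivial: "\<exists>u::'f. u \<noteq> 0" and Q: "T_set Q" and Q': "T_set Q'"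
    and incl: "peak B y Q \<subseteq> peak B y' Q'"
  shows "y = y' \<and> Q = Q'"
proof -
  have "y = y'"
  proof (rule ccontr)
    assume ne: "y \<noteq> y'"
    obtain u where u: "u \<in> Q" "norm u = 1"
      using T_set_has_vector_of_norm[OF Q nontrivial, of 1] by auto
    obtain f where f: "f \<in> B" "apply_bcontfun f y = u" "norm f = norm u" "apply_bcontfun f y' = 0"
      using sep ne unfolding separating_def by blast
    then have "f \<in> peak B y Q"
      using u unfolding peak_def by simp
    then have "f \<in> peak B y' Q'"
      using incl by blast
    then show False
      using f u unfolding peak_def by simp
  qed
  have "u \<in> Q'" if "u \<in> Q" for u
  proof -
    have "const_bcontfun u \<in> peak B y Q"
      using that const unfolding peak_def by auto
    then have "const_bcontfun u \<in> peak B y' Q'"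
      using incl by blast
    then show ?thesis
      unfolding peak_def by simp
  qed
  then have "Q' = Q"
    using Q Q' unfolding T_set_def by blast
  then show ?thesis
    using \<open>y = y'\<close> by simp
qed

lemma completely_regular_bump:
  assumes "completely_regular A" "open U" "x \<in> U"
  obtains f where "f \<in> A" "apply_bcontfun f x = u" "norm f = norm u"
    "\<And>z. z \<notin> U \<Longrightarrow> apply_bcontfun f z = 0"
  using assms unfolding completely_regular_def by (metis interior_open)

lemma completely_regular_imp_separating:
  fixes A :: "('x::t2_space \<Rightarrow>\<^sub>C 'e::real_normed_vector) set"
  assumes "completely_regular A"
  shows "separating A"
  unfolding separating_def
proof (intro allI impI)
  fix x1 x2 :: 'x and u :: 'e
  assume "x1 \<noteq> x2"
  then obtain f where "f \<in> A" "apply_bcontfun f x1 = u" "norm f = norm u"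
      "\<And>z. z \<notin> - {x2} \<Longrightarrow> apply_bcontfun f z = 0"
    using completely_regular_bump[OF assms, of "- {x2}" x1 u] by auto
  then show "\<exists>f\<in>A. apply_bcontfun f x1 = u \<and> norm f = norm u \<and> apply_bcontfun f x2 = 0"
    by auto
qed

text \<open>Two bumps with disjoint supports do not interact, so their sum still peaks at both points.\<close>
lemma two_point_bump:
  fixes A :: "('x::t2_space \<Rightarrow>\<^sub>C 'e::real_normed_vector) set"
  assumes A: "completely_regular A" "subspace A" and ne: "x \<noteq> x'" and uv: "norm u = norm v"
  shows "\<exists>f\<in>A. apply_bcontfun f x = u \<and> apply_bcontfun f x' = v \<and> norm f = norm u"
proof -
  obtain U U' where U: "open U" "open U'" "x \<in> U" "x' \<in> U'" "U \<inter> U' = {}"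
    using hausdorff[OF ne] by blast
  obtain f where f: "f \<in> A" "apply_bcontfun f x = u" "norm f = norm u"
      "\<And>z. z \<notin> U \<Longrightarrow> apply_bcontfun f z = 0"
    using completely_regular_bump[OF A(1) U(1,3)] by metis
  obtain g where g: "g \<in> A" "apply_bcontfun g x' = v" "norm g = norm v"
      "\<And>z. z \<notin> U' \<Longrightarrow> apply_bcontfun g z = 0"
    using completely_regular_bump[OF A(1) U(2,4)] by metis
  have val: "apply_bcontfun (f + g) x = u" "apply_bcontfun (f + g) x' = v"
    using f g U by auto
  have "norm (apply_bcontfun (f + g) z) \<le> norm u" for z
  proof (cases "z \<in> U")
    case True
    then have "apply_bcontfun g z = 0"
      using g U by blast
    then show ?thesis
      using norm_bounded[of f z] f by simp
  next
    case False
    then show ?thesis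
      using norm_bounded[of g z] f g uv by simp
  qed
  then have "norm (f + g) \<le> norm u"
    by (rule norm_bound)
  moreover have "norm u \<le> norm (f + g)"
    using norm_bounded[of "f + g" x] val by simp
  moreover have "f + g \<in> A"
    using A f g by (simp add: subspace_add)
  ultimately show ?thesis
    using val by (intro bexI[of _ "f + g"]) auto
qed

section \<open>Sup-norm isometries between function spaces\<close>

locale sup_isometry =
  fixes A :: "('x::t2_space \<Rightarrow>\<^sub>C 'e::real_normed_vector) set"
    and B :: "('y::t2_space \<Rightarrow>\<^sub>C 'f::real_normed_vector) set"
    and T :: "('x \<Rightarrow>\<^sub>C 'e) \<Rightarrow> ('y \<Rightarrow>\<^sub>C 'f)"
    and S :: "('y \<Rightarrow>\<^sub>C 'f) \<Rightarrow> ('x \<Rightarrow>\<^sub>C 'e)"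
  assumes compact_X: "compact (UNIV :: 'x set)" and compact_Y: "compact (UNIV :: 'y set)"
    and nontrivial_E: "\<exists>u::'e. u \<noteq> 0" and nontrivial_F: "\<exists>u::'f. u \<noteq> 0"
    and subspace_A: "subspace A" and subspace_B: "subspace B"
    and const_A: "range const_bcontfun \<subseteq> A" and const_B: "range const_bcontfun \<subseteq> B"
    and T_in: "f \<in> A \<Longrightarrow> T f \<in> B" and S_in: "g \<in> B \<Longrightarrow> S g \<in> A"
    and S_T: "f \<in> A \<Longrightarrow> S (T f) = f" and T_S: "g \<in> B \<Longrightarrow> T (S g) = g"
    and T_add: "\<lbrakk>f \<in> A; f' \<in> A\<rbrakk> \<Longrightarrow> T (f + f') = T f + T f'"
    and T_scaleR: "f \<in> A \<Longrightarrow> T (c *\<^sub>R f) = c *\<^sub>R T f"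
    and norm_T: "f \<in> A \<Longrightarrow> norm (T f) = norm f"
begin

lemma inverse_isometry: "sup_isometry B A S T"
proof unfold_locales
  show "S (g + g') = S g + S g'" if "g \<in> B" "g' \<in> B" for g g'
    using that by (metis S_in S_T T_S T_add subspace_A subspace_add)
  show "S (c *\<^sub>R g) = c *\<^sub>R S g" if "g \<in> B" for g c
    using that by (metis S_in S_T T_S T_scaleR subspace_A subspace_scale)
  show "norm (S g) = norm g" if "g \<in> B" for g
    using that by (metis S_in T_S norm_T)
qed (use compact_X compact_Y nontrivial_E nontrivial_F subspace_A subspace_B const_A const_B
      T_in S_in S_T T_S in auto)

lemma const_in_A [simp]: "const_bcontfun e \<in> A"
  using const_A by auto

lemma const_in_B [simp]: "const_bcontfun e \<in> B"
  using const_B by auto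

lemma T_zero: "T 0 = 0"
  using norm_T[of 0] subspace_0[OF subspace_A] by simp

lemma T_sum_list:
  assumes "set fs \<subseteq> A"
  shows "sum_list fs \<in> A \<and> T (sum_list fs) = sum_list (map T fs)"
  using assms by (induction fs) (auto simp: T_zero T_add subspace_A subspace_0 subspace_add)

lemma norm_additive_image:
  assumes N: "norm_additive N" "N \<subseteq> A"
  shows "norm_additive (T ` N)"
  unfolding norm_additive_def
proof (intro allI impI)
  fix gs assume "set gs \<subseteq> T ` N"
  then have "gs \<in> lists (T ` N)"
    by auto
  then obtain fs where fs: "set fs \<subseteq> N" "gs = map T fs"
    unfolding lists_image by auto
  then have fsA: "set fs \<subseteq> A"
    using N by auto
  have "norm (sum_list gs) = norm (sum_list fs)"
    using T_sum_list[OF fsA] norm_T fs by metis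
  also have "\<dots> = sum_list (map norm fs)"
    using N fs unfolding norm_additive_def by blast
  also have "map norm fs = map norm gs"
    using fs fsA norm_T by auto
  finally show "norm (sum_list gs) = sum_list (map norm gs)" .
qed

text \<open>
  The preimage of \<open>peak B y Q\<close> is norm additive, hence contained in some \<open>peak A x R\<close>, whose image is
  in turn contained in a peak set of \<open>B\<close>.  As \<open>B\<close> is separating, the outer inclusion between peak
  sets of \<open>B\<close> is an equality.
\<close>
lemma peak_is_image:
  assumes sep: "separating B" and Q: "T_set Q"
  shows "\<exists>x R. T_set R \<and> T ` peak A x R = peak B y Q"
proof -
  interpret inv: sup_isometry B A S T
    by (rule inverse_isometry)
  have sub: "peak A x R \<subseteq> A" "peak B z P \<subseteq> B" for x R z P
    unfolding peak_def by auto
  have "norm_additive (S ` peak B y Q)"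
    using Q sub by (intro inv.norm_additive_image norm_additive_peak) (auto simp: T_set_def)
  moreover have "S ` peak B y Q \<subseteq> A"
    using sub S_in by blast
  ultimately obtain x R where R: "T_set R" "S ` peak B y Q \<subseteq> peak A x R"
    using norm_additive_imp_peak[OF compact_X, of "S ` peak B y Q" A] by metis
  have "norm_additive (T ` peak A x R)"
    using R sub by (intro norm_additive_image norm_additive_peak) (auto simp: T_set_def)
  moreover have "T ` peak A x R \<subseteq> B"
    using sub T_in by blast
  ultimately obtain y' Q' where Q': "T_set Q'" "T ` peak A x R \<subseteq> peak B y' Q'"
    using norm_additive_imp_peak[OF compact_Y, of "T ` peak A x R" B] by metis
  have "g = T (S g)" if "g \<in> peak B y Q" for g
    using that T_S unfolding peak_def by simp
  then have incl: "peak B y Q \<subseteq> T ` peak A x R"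
    using R by blast
  then have "y = y' \<and> Q = Q'"
    using Q Q' by (intro peak_inclusion_imp_eq[OF sep const_B nontrivial_F]) auto
  then show ?thesis
    using incl R Q' by blast
qed

text \<open>
  A function peaking simultaneously at distinct points \<open>x\<close> and \<open>x'\<close> in the directions \<open>R\<close> and \<open>R'\<close>
  would have an image attaining its nonzero norm at \<open>y\<close> with a value in \<open>Q \<inter> Q'\<close>.
\<close>
lemma disjoint_T_sets_same_point:
  assumes reg: "completely_regular A"
    and R: "T_set R" "T ` peak A x R = peak B y Q"
    and R': "T_set R'" "T ` peak A x' R' = peak B y Q'"
    and disj: "Q \<inter> Q' = {0}"
  shows "x = x'"
proof (rule ccontr)
  assume ne: "x \<noteq> x'"
  obtain u where u: "u \<in> R" "norm u = 1"
    using T_set_has_vector_of_norm[OF R(1) nontrivial_E, of 1] by auto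
  obtain v where v: "v \<in> R'" "norm v = 1"
    using T_set_has_vector_of_norm[OF R'(1) nontrivial_E, of 1] by auto
  obtain f where f: "f \<in> A" "apply_bcontfun f x = u" "apply_bcontfun f x' = v" "norm f = norm u"
    using two_point_bump[OF reg subspace_A ne] u v by metis
  have "f \<in> peak A x R" "f \<in> peak A x' R'"
    using f u v unfolding peak_def by auto
  then have "T f \<in> peak B y Q" "T f \<in> peak B y Q'"
    using R R' by blast+
  then have "norm (T f) = 0"
    using disj unfolding peak_def by (metis (mono_tags, lifting) IntI mem_Collect_eq norm_zero singletonD)
  then show False
    using norm_T f u by simp
qed

text \<open>
  The point is the one belonging to the distinguished T-set \<open>Q0\<close> of property \<open>(D\<^sub>w)\<close>.  It agrees with
  the point of any other T-set \<open>Q\<close>, directly if \<open>Q0\<close> and \<open>Q\<close> meet only in \<open>0\<close>, and otherwise by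
  comparing both with the point of the intermediate T-set \<open>L\<close>.
\<close>
lemma common_peak_point:
  assumes reg: "completely_regular A" and sep: "separating B" and Dw: "property_Dw TYPE('f)"
  shows "\<exists>x. \<forall>Q. T_set Q \<longrightarrow> (\<exists>R. T_set R \<and> T ` peak A x R = peak B y Q)"
proof -
  obtain Q0 :: "'f set" where "T_set Q0 \<and> (\<forall>Q. T_set Q \<and> Q \<noteq> Q0 \<longrightarrow>
       Q0 \<inter> Q = {0} \<or> (\<exists>L. T_set L \<and> Q0 \<inter> L = {0} \<and> Q \<inter> L = {0}))"
    using Dw unfolding property_Dw_def by (rule exE)
  then have Q0: "T_set Q0" and Dw0: "\<And>Q. T_set Q \<Longrightarrow> Q \<noteq> Q0 \<Longrightarrow>
       Q0 \<inter> Q = {0} \<or> (\<exists>L. T_set L \<and> Q0 \<inter> L = {0} \<and> Q \<inter> L = {0})"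
    by simp_all
  obtain x R0 where R0: "T_set R0" "T ` peak A x R0 = peak B y Q0"
    using peak_is_image[OF sep Q0] by blast
  have "\<exists>R. T_set R \<and> T ` peak A x R = peak B y Q" if Q: "T_set Q" for Q
  proof (cases "Q = Q0")
    case True
    then show ?thesis
      using R0 by blast
  next
    case False
    obtain x' R where R: "T_set R" "T ` peak A x' R = peak B y Q"
      using peak_is_image[OF sep Q] by blast
    consider "Q0 \<inter> Q = {0}" | L where "T_set L" "Q0 \<inter> L = {0}" "Q \<inter> L = {0}"
      using Dw0[OF Q False] by metis
    then have "x = x'"
    proof cases
      case 1
      then show ?thesis
        using disjoint_T_sets_same_point[OF reg R0 R] by simp
    next
      case 2
      obtain z P where P: "T_set P" "T ` peak A z P = peak B y L"
        using peak_is_image[OF sep 2(1)] by blast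
      have "x = z" "x' = z"
        using disjoint_T_sets_same_point[OF reg R0 P] disjoint_T_sets_same_point[OF reg R P] 2
        by auto
      then show ?thesis
        by simp
    qed
    then show ?thesis
      using R by metis
  qed
  then show ?thesis
    by metis
qed

text \<open>
  A bump \<open>h\<close> at \<open>x\<close> of norm \<open>s = norm f\<close> supported where \<open>f\<close> is smaller than \<open>\<epsilon>\<close> satisfies
  \<open>norm (f + h) \<le> s + \<epsilon>\<close>.  If its value at \<open>x\<close> lies in the T-set matched with one containing
  \<open>T f y\<close>, the norms of \<open>T f y\<close> and \<open>T h y\<close> add up, so \<open>norm (T f y) + s \<le> s + \<epsilon>\<close>.
\<close>
lemma image_vanishes:
  assumes reg: "completely_regular A"
    and x: "\<And>Q. T_set Q \<Longrightarrow> \<exists>R. T_set R \<and> T ` peak A x R = peak B y Q"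
    and f: "f \<in> A" "apply_bcontfun f x = 0"
  shows "apply_bcontfun (T f) y = 0"
proof -
  obtain Q where Q: "T_set Q" "apply_bcontfun (T f) y \<in> Q"
    using T_set_containing by blast
  obtain R where R: "T_set R" "T ` peak A x R = peak B y Q"
    using x[OF Q(1)] by blast
  obtain r where r: "r \<in> R" "norm r = norm f"
    using T_set_has_vector_of_norm[OF R(1) nontrivial_E, of "norm f"] by auto
  have "norm (apply_bcontfun (T f) y) \<le> 0 + \<epsilon>" if \<epsilon>: "\<epsilon> > 0" for \<epsilon>
  proof -
    let ?U = "{z. norm (apply_bcontfun f z) < \<epsilon>}"
    have "open ?U"
      by (intro open_Collect_less continuous_on_norm) auto
    then obtain h where h: "h \<in> A" "apply_bcontfun h x = r" "norm h = norm r"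
        "\<And>z. z \<notin> ?U \<Longrightarrow> apply_bcontfun h z = 0"
      using completely_regular_bump[OF reg, of ?U x r] f \<epsilon> by auto
    have "norm (apply_bcontfun (f + h) z) \<le> norm f + \<epsilon>" for z
    proof (cases "z \<in> ?U")
      case True
      then show ?thesis
        using norm_triangle_ineq[of "f z" "h z"] norm_bounded[of h z] h r by simp
    next
      case False
      then show ?thesis
        using norm_bounded[of f z] h \<epsilon> by simp
    qed
    then have fh: "norm (f + h) \<le> norm f + \<epsilon>"
      by (rule norm_bound)
    have "h \<in> peak A x R"
      using h r unfolding peak_def by simp
    then have Th: "T h \<in> peak B y Q"
      using R by blast
    have "norm (apply_bcontfun (T f) y) + norm f = norm (apply_bcontfun (T f) y + apply_bcontfun (T h) y)"
      using norm_additive_pair[of Q "T f y" "T h y"] Q Th norm_T h r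
      unfolding T_set_def peak_def by simp
    also have "\<dots> = norm (apply_bcontfun (T (f + h)) y)"
      using T_add f h by simp
    also have "\<dots> \<le> norm (T (f + h))"
      by (rule norm_bounded)
    also have "\<dots> = norm (f + h)"
      using norm_T f h subspace_A by (simp add: subspace_add)
    finally show ?thesis
      using fh by simp
  qed
  then have "norm (apply_bcontfun (T f) y) \<le> 0"
    by (rule field_le_epsilon)
  then show ?thesis
    by simp
qed

text \<open>
  Every value \<open>u\<close> at \<open>y\<close> is that of a constant function on \<open>Y\<close>, whose preimage may be replaced by
  the constant function with its value at \<open>\<phi> y\<close>.
\<close>
lemma const_values_surj:
  assumes "\<And>f y. f \<in> A \<Longrightarrow> T f y = T (const_bcontfun (f (\<phi> y))) y"
  shows "\<exists>e. T (const_bcontfun e) y = u"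
proof -
  have "apply_bcontfun (T (S (const_bcontfun u))) y = u"
    using T_S by simp
  then show ?thesis
    using assms[of "S (const_bcontfun u)" y] S_in by auto
qed

text \<open>
  Since \<open>T f\<close> vanishes at \<open>y\<close> whenever \<open>f\<close> vanishes at \<open>\<phi> y\<close>, the image of a bump supported in \<open>U\<close>
  can be nonzero only where \<open>\<phi> y \<in> U\<close>.  For a bump at \<open>\<phi> y0\<close> with \<open>T f y0 \<noteq> 0\<close> this gives
  continuity at \<open>y0\<close>; a bump supported off the range of \<open>\<phi>\<close> would have image \<open>0\<close>, which gives
  surjectivity.
\<close>
lemma weighted_composition:
  assumes reg: "completely_regular A" and sep: "separating B" and Dw: "property_Dw TYPE('f)"
  shows "\<exists>\<phi>. continuous_on UNIV \<phi> \<and> surj \<phi> \<and>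
     (\<forall>f\<in>A. \<forall>y. apply_bcontfun (T f) y = apply_bcontfun (T (const_bcontfun (apply_bcontfun f (\<phi> y)))) y)"
proof -
  have "\<forall>y. \<exists>x. \<forall>Q. T_set Q \<longrightarrow> (\<exists>R. T_set R \<and> T ` peak A x R = peak B y Q)"
    using common_peak_point[OF reg sep Dw] by blast
  then obtain \<phi> where \<phi>: "\<And>y Q. T_set Q \<Longrightarrow> \<exists>R. T_set R \<and> T ` peak A (\<phi> y) R = peak B y Q"
    by metis
  have vanish: "apply_bcontfun (T f) y = 0" if "f \<in> A" "apply_bcontfun f (\<phi> y) = 0" for f y
    using image_vanishes[OF reg \<phi>] that by blast
  have repr: "apply_bcontfun (T f) y = apply_bcontfun (T (const_bcontfun (apply_bcontfun f (\<phi> y)))) y"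
    if f: "f \<in> A" for f y
  proof -
    define c where "c = (const_bcontfun (apply_bcontfun f (\<phi> y)) :: 'x \<Rightarrow>\<^sub>C 'e)"
    have c: "c \<in> A" "f - c \<in> A" "apply_bcontfun (f - c) (\<phi> y) = 0"
      unfolding c_def using f subspace_A by (auto simp: subspace_diff)
    have "T f = T (f - c) + T c"
      using T_add[OF c(2,1)] by simp
    then have "apply_bcontfun (T f) y = apply_bcontfun (T c) y"
      using vanish[OF c(2,3)] by simp
    then show ?thesis
      unfolding c_def .
  qed
  have cont: "continuous_on UNIV \<phi>"
    unfolding continuous_on_topological
  proof (intro ballI allI impI)
    fix y0 and U :: "'x set" assume U: "open U" "\<phi> y0 \<in> U"
    obtain u :: 'f where u: "u \<noteq> 0"
      using nontrivial_F by blast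
    obtain e where e: "apply_bcontfun (T (const_bcontfun e)) y0 = u"
      using const_values_surj[of \<phi>, OF repr] by blast
    obtain f where f: "f \<in> A" "apply_bcontfun f (\<phi> y0) = e" "\<And>z. z \<notin> U \<Longrightarrow> apply_bcontfun f z = 0"
      using completely_regular_bump[OF reg U] by metis
    let ?W = "{y. apply_bcontfun (T f) y \<noteq> 0}"
    have "open ?W"
      by (intro open_Collect_neq) auto
    moreover have "y0 \<in> ?W"
      using repr[OF f(1), of y0] e f u by simp
    moreover have "\<phi> y \<in> U" if "y \<in> ?W" for y
      using that vanish[OF f(1)] f(3) by auto
    ultimately show "\<exists>W. open W \<and> y0 \<in> W \<and> (\<forall>y\<in>UNIV. y \<in> W \<longrightarrow> \<phi> y \<in> U)"
      by blast
  qed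
  have "surj \<phi>"
  proof (rule ccontr)
    assume "\<not> surj \<phi>"
    then obtain x where x: "x \<in> - range \<phi>"
      by auto
    have "open (- range \<phi>)"
      using compact_continuous_image[OF cont compact_Y] compact_imp_closed by auto
    moreover obtain e :: 'e where e: "e \<noteq> 0"
      using nontrivial_E by blast
    ultimately obtain f where f: "f \<in> A" "apply_bcontfun f x = e"
        "\<And>z. z \<notin> - range \<phi> \<Longrightarrow> apply_bcontfun f z = 0"
      using completely_regular_bump[OF reg _ x] by metis
    have "T f = 0"
      using vanish[OF f(1)] f(3) by (intro bcontfun_eqI) auto
    then have "f = 0"
      using norm_T[OF f(1)] by simp
    then show False
      using f e by simp
  qed
  then show ?thesis
    using cont repr by blast
qed

text \<open>
  If \<open>\<phi> (\<psi> x)\<close> differed from \<open>x\<close>, a function vanishing at \<open>\<phi> (\<psi> x)\<close> but not at \<open>x\<close> would have an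
  image vanishing at \<open>\<psi> x\<close>, and hence be recovered from it with the value \<open>0\<close> at \<open>x\<close>.
\<close>
lemma point_maps_inverse:
  assumes sep: "separating A"
    and \<phi>: "\<forall>f\<in>A. \<forall>y. apply_bcontfun (T f) y = apply_bcontfun (T (const_bcontfun (apply_bcontfun f (\<phi> y)))) y"
    and \<psi>: "\<forall>g\<in>B. \<forall>x. apply_bcontfun (S g) x = apply_bcontfun (S (const_bcontfun (apply_bcontfun g (\<psi> x)))) x"
  shows "\<phi> (\<psi> x) = x"
proof (rule ccontr)
  assume ne: "\<phi> (\<psi> x) \<noteq> x"
  interpret inv: sup_isometry B A S T
    by (rule inverse_isometry)
  obtain u :: 'e where u: "u \<noteq> 0"
    using nontrivial_E by blast
  obtain f where f: "f \<in> A" "apply_bcontfun f x = u" "apply_bcontfun f (\<phi> (\<psi> x)) = 0"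
    using sep ne unfolding separating_def by metis
  have "apply_bcontfun (T f) (\<psi> x) = 0"
    using bspec[OF \<phi> f(1)] f(3) by (simp add: T_zero)
  then have "apply_bcontfun (S (T f)) x = 0"
    using bspec[OF \<psi> T_in[OF f(1)]] by (simp add: inv.T_zero)
  then show False
    using S_T f u by simp
qed

text \<open>
  The value map \<open>e \<mapsto> T e^ (\<psi> x)\<close> on constants is a contraction, and the corresponding contraction
  of \<open>S\<close> at \<open>x\<close> is a left inverse of it, so it cannot shrink norms.
\<close>
lemma const_value_norm:
  assumes \<psi>: "\<forall>g\<in>B. \<forall>x. apply_bcontfun (S g) x = apply_bcontfun (S (const_bcontfun (apply_bcontfun g (\<psi> x)))) x"
  shows "norm (apply_bcontfun (T (const_bcontfun e)) (\<psi> x)) = norm e"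
proof (rule antisym)
  interpret inv: sup_isometry B A S T
    by (rule inverse_isometry)
  show "norm (apply_bcontfun (T (const_bcontfun e)) (\<psi> x)) \<le> norm e"
    using norm_bounded[of "T (const_bcontfun e)" "\<psi> x"] norm_T[of "const_bcontfun e"] by simp
  define c where "c = (const_bcontfun (apply_bcontfun (T (const_bcontfun e)) (\<psi> x)) :: 'y \<Rightarrow>\<^sub>C 'f)"
  have "e = apply_bcontfun (S (T (const_bcontfun e))) x"
    using S_T by simp
  also have "\<dots> = apply_bcontfun (S c) x"
    unfolding c_def using \<psi> T_in[OF const_in_A] by blast
  finally have "norm e \<le> norm (S c)"
    using norm_bounded[of "S c" x] by simp
  also have "\<dots> = norm (apply_bcontfun (T (const_bcontfun e)) (\<psi> x))"
    unfolding c_def by (subst inv.norm_T) auto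
  finally show "norm e \<le> norm (apply_bcontfun (T (const_bcontfun e)) (\<psi> x))" .
qed

lemma bounded_linear_const_value: "bounded_linear (\<lambda>e. apply_bcontfun (T (const_bcontfun e)) y)"
proof (rule bounded_linear_intro[where K = 1])
  show "norm (apply_bcontfun (T (const_bcontfun e)) y) \<le> norm e * 1" for e
    using norm_bounded[of "T (const_bcontfun e)" y] norm_T[of "const_bcontfun e"] by simp
qed (simp_all add: const_bcontfun_add const_bcontfun_scaleR T_add T_scaleR)

end

section \<open>Removing the seminorms\<close>

lemma surj_linear_isometry_inj_on:
  fixes A :: "('v::real_normed_vector) set"
  assumes T: "surj_linear_isometry A nA B nB T" and A: "subspace A"
    and nA: "\<And>f. f \<in> A \<Longrightarrow> norm f \<le> nA f" and nB: "nB 0 = 0"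
  shows "inj_on T A"
proof (rule inj_onI)
  fix f g assume fg: "f \<in> A" "g \<in> A" "T f = T g"
  have m: "(-1) *\<^sub>R g \<in> A"
    using fg A by (intro subspace_scale)
  have "T (f + (-1) *\<^sub>R g) = T f + (-1) *\<^sub>R T g"
    using T fg m unfolding surj_linear_isometry_def by metis
  then have "nA (f + (-1) *\<^sub>R g) = 0"
    using T fg m A nB unfolding surj_linear_isometry_def
    by (metis add.right_inverse scaleR_minus1_left subspace_add)
  then show "f = g"
    using nA[of "f + (-1) *\<^sub>R g"] m fg A by (simp add: subspace_diff)
qed

lemma surj_linear_isometry_inverse:
  assumes T: "surj_linear_isometry A nA B nB T" and inj: "inj_on T A" and A: "subspace A"
  shows "surj_linear_isometry B nB A nA (inv_into A T)"
proof -
  have TB: "T ` A = B" and add: "\<And>f g. f \<in> A \<Longrightarrow> g \<in> A \<Longrightarrow> T (f + g) = T f + T g"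
    and scale: "\<And>c f. f \<in> A \<Longrightarrow> T (c *\<^sub>R f) = c *\<^sub>R T f"
    and iso: "\<And>f. f \<in> A \<Longrightarrow> nB (T f) = nA f"
    using T unfolding surj_linear_isometry_def by auto
  have inv: "inv_into A T (T f) = f" if "f \<in> A" for f
    using inj that by simp
  show ?thesis
    unfolding surj_linear_isometry_def TB[symmetric]
  proof (intro conjI ballI allI)
    show "inv_into A T ` T ` A = A"
      using inv by (simp add: image_image)
  next
    fix g g' assume "g \<in> T ` A" "g' \<in> T ` A"
    then obtain f f' where f: "f \<in> A" "f' \<in> A" "g = T f" "g' = T f'"
      by auto
    then have "f + f' \<in> A"
      using A by (simp add: subspace_add)
    then show "inv_into A T (g + g') = inv_into A T g + inv_into A T g'"
      using f inv add by metis
  next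
    fix c g assume "g \<in> T ` A"
    then obtain f where f: "f \<in> A" "g = T f"
      by auto
    then have "c *\<^sub>R f \<in> A"
      using A by (simp add: subspace_scale)
    then show "inv_into A T (c *\<^sub>R g) = c *\<^sub>R inv_into A T g"
      using f inv scale by metis
  next
    fix g assume "g \<in> T ` A"
    then show "nA (inv_into A T g) = nB g"
      using inv iso by auto
  qed
qed

text \<open>
  If \<open>nA f\<close> exceeds \<open>norm f\<close>, then it equals \<open>p f\<close>, so \<open>f + \<epsilon> v\<close> has the same bound \<open>p f\<close> on its norm for all
  constants \<open>v\<close> of norm one and \<open>\<epsilon> = p f - norm f\<close>.  At a point where \<open>T f\<close> attains its norm this
  contradicts property (St) for the vector \<open>T f y / \<epsilon>\<close>.
\<close>
lemma sup_norm_dominates_preimage: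
  fixes A :: "('x::topological_space \<Rightarrow>\<^sub>C 'e::real_normed_vector) set"
    and B :: "('y::topological_space \<Rightarrow>\<^sub>C 'f::real_normed_vector) set"
  assumes comp: "compact (UNIV :: 'y set)"
    and A: "subspace A" "range const_bcontfun \<subseteq> A"
    and p: "seminorm_on A p" "\<And>v. p (const_bcontfun v) = 0"
    and nA: "\<And>f. f \<in> A \<Longrightarrow> nA f = max (norm f) (p f)"
    and nB: "\<And>g. g \<in> B \<Longrightarrow> norm g \<le> nB g"
    and T: "surj_linear_isometry A nA B nB T" and St: "property_St T"
    and f: "f \<in> A" "nB (T f) = norm (T f)"
  shows "nA f = norm f"
proof (rule ccontr)
  assume "nA f \<noteq> norm f"
  then have pf: "norm f < p f" "nA f = p f"
    using nA[OF f(1)] by auto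
  have TB: "\<And>h. h \<in> A \<Longrightarrow> T h \<in> B" and add: "\<And>h g. h \<in> A \<Longrightarrow> g \<in> A \<Longrightarrow> T (h + g) = T h + T g"
    and scale: "\<And>c h. h \<in> A \<Longrightarrow> T (c *\<^sub>R h) = c *\<^sub>R T h"
    and iso: "\<And>h. h \<in> A \<Longrightarrow> nB (T h) = nA h"
    using T unfolding surj_linear_isometry_def by auto
  define \<epsilon> where "\<epsilon> = p f - norm f"
  have \<epsilon>: "\<epsilon> > 0"
    using pf \<epsilon>_def by simp
  obtain y where y: "norm (apply_bcontfun (T f) y) = norm (T f)"
    using bcontfun_norm_attained[OF comp] by blast
  obtain v where v: "norm v = 1"
    "norm (apply_bcontfun (T (const_bcontfun v)) y + (1 / \<epsilon>) *\<^sub>R apply_bcontfun (T f) y)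
       > norm ((1 / \<epsilon>) *\<^sub>R apply_bcontfun (T f) y)"
    using St unfolding property_St_def by fastforce
  define c where "c = (const_bcontfun v :: 'x \<Rightarrow>\<^sub>C 'e)"
  have c: "c \<in> A" "\<epsilon> *\<^sub>R c \<in> A" "f + \<epsilon> *\<^sub>R c \<in> A"
    using A f unfolding c_def by (auto intro!: subspace_add subspace_scale)
  have "norm (f + \<epsilon> *\<^sub>R c) \<le> norm f + \<epsilon>"
    using norm_triangle_ineq[of f "\<epsilon> *\<^sub>R c"] v \<epsilon> unfolding c_def by simp
  moreover have "p (f + \<epsilon> *\<^sub>R c) \<le> p f + p (\<epsilon> *\<^sub>R c)"
    using p(1) f c unfolding seminorm_on_def by blast
  moreover have "p (\<epsilon> *\<^sub>R c) = 0"
    using p(2)[of "\<epsilon> *\<^sub>R v"] unfolding c_def by (simp add: const_bcontfun_scaleR)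
  ultimately have "nA (f + \<epsilon> *\<^sub>R c) \<le> p f"
    using nA[OF c(3)] unfolding \<epsilon>_def by simp
  then have "norm (T (f + \<epsilon> *\<^sub>R c)) \<le> norm (T f)"
    using nB[OF TB[OF c(3)]] iso[OF c(3)] iso[OF f(1)] f(2) pf by simp
  then have "norm (apply_bcontfun (T f) y + \<epsilon> *\<^sub>R apply_bcontfun (T c) y) \<le> norm (apply_bcontfun (T f) y)"
    using norm_bounded[of "T (f + \<epsilon> *\<^sub>R c)" y] add[OF f(1) c(2)] scale[OF c(1)] y by simp
  moreover have "apply_bcontfun (T f) y + \<epsilon> *\<^sub>R apply_bcontfun (T c) y
      = \<epsilon> *\<^sub>R (apply_bcontfun (T c) y + (1 / \<epsilon>) *\<^sub>R apply_bcontfun (T f) y)"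
    using \<epsilon> by (simp add: algebra_simps)
  moreover have "norm (apply_bcontfun (T f) y)
      < \<epsilon> * norm (apply_bcontfun (T c) y + (1 / \<epsilon>) *\<^sub>R apply_bcontfun (T f) y)"
    using v(2) \<epsilon> unfolding c_def by (simp add: field_simps)
  ultimately show False
    using \<epsilon> by simp
qed

text \<open>
  Let \<open>u\<close> be a value of \<open>T f\<close> of maximal norm \<open>k\<close>.  Adding the constant \<open>t u\<close> to \<open>T f\<close> raises its
  supremum norm by \<open>t k\<close> and leaves the seminorm unchanged, so that for large \<open>t\<close> the sum and
  its preimage both have sup-norm \<open>(1 + t) k\<close>.  As the preimage of the constant has norm at most
  \<open>t k\<close>, the function \<open>f\<close> has norm at least \<open>k\<close>.
\<close>
lemma norm_isometry_le:
  fixes A :: "('x::topological_space \<Rightarrow>\<^sub>C 'e::real_normed_vector) set"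
    and B :: "('y::topological_space \<Rightarrow>\<^sub>C 'f::real_normed_vector) set"
  assumes comp: "compact (UNIV :: 'y set)"
    and A: "subspace A" "range const_bcontfun \<subseteq> A"
    and B: "subspace B" "range const_bcontfun \<subseteq> B"
    and p: "seminorm_on A p" "\<And>v. p (const_bcontfun v) = 0"
    and q: "seminorm_on B q" "\<And>v. q (const_bcontfun v) = 0"
    and nA: "\<And>f. f \<in> A \<Longrightarrow> nA f = max (norm f) (p f)"
    and nB: "\<And>g. g \<in> B \<Longrightarrow> nB g = max (norm g) (q g)"
    and T: "surj_linear_isometry A nA B nB T" and St: "property_St T"
    and f: "f \<in> A"
  shows "norm (T f) \<le> norm f"
proof (cases "T f = 0")
  case False
  have TB: "T ` A = B" and add: "\<And>h g. h \<in> A \<Longrightarrow> g \<in> A \<Longrightarrow> T (h + g) = T h + T g"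
    and iso: "\<And>h. h \<in> A \<Longrightarrow> nB (T h) = nA h"
    using T unfolding surj_linear_isometry_def by auto
  obtain y where y: "norm (apply_bcontfun (T f) y) = norm (T f)"
    using bcontfun_norm_attained[OF comp] by blast
  define k where "k = norm (T f)"
  have k: "k > 0"
    using False k_def by simp
  define t where "t = \<bar>q (T f)\<bar> / k"
  have t: "0 \<le> t" "q (T f) \<le> (1 + t) * k"
    unfolding t_def using k by (auto simp: distrib_right)
  define c where "c = (const_bcontfun (t *\<^sub>R apply_bcontfun (T f) y) :: 'y \<Rightarrow>\<^sub>C 'f)"
  have c: "c \<in> B" "T f \<in> B" "T f + c \<in> B"
    using B f TB unfolding c_def by (auto intro!: subspace_add)
  have norm_c: "norm c = t * k"
    using t y unfolding c_def k_def by simp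
  have "apply_bcontfun (T f + c) y = (1 + t) *\<^sub>R apply_bcontfun (T f) y"
    unfolding c_def by (simp add: algebra_simps)
  then have "norm (apply_bcontfun (T f + c) y) = (1 + t) * k"
    using t y unfolding k_def by simp
  then have "(1 + t) * k \<le> norm (T f + c)"
    using norm_bounded[of "T f + c" y] by simp
  then have norm_sum: "norm (T f + c) = (1 + t) * k"
    using norm_triangle_ineq[of "T f" c] norm_c unfolding k_def by (simp add: algebra_simps)
  have "q (T f + c) \<le> q (T f) + q c"
    using q(1) c unfolding seminorm_on_def by blast
  then have "nB (T f + c) = norm (T f + c)"
    using nB[OF c(3)] q(2) t norm_sum unfolding c_def by simp
  moreover obtain h where h: "h \<in> A" "T h = c"
    using TB c by auto
  moreover have fh: "f + h \<in> A" "T (f + h) = T f + c"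
    using A f h add by (auto intro: subspace_add)
  ultimately have "nA (f + h) = norm (f + h)"
    by (intro sup_norm_dominates_preimage[where B = B and T = T and p = p and nB = nB, OF comp A])
      (simp_all add: p nA nB T St)
  then have "(1 + t) * k = norm (f + h)"
    using iso[OF fh(1)] fh \<open>nB (T f + c) = norm (T f + c)\<close> norm_sum by simp
  moreover have "norm h \<le> t * k"
  proof -
    have "norm h \<le> nA h"
      using nA h by simp
    also have "\<dots> = nB c"
      using iso h by metis
    also have "\<dots> = t * k"
      using nB[OF c(1)] q(2) norm_c t k unfolding c_def by simp
    finally show ?thesis .
  qed
  ultimately show ?thesis
    using norm_triangle_ineq[of f h] unfolding k_def by (simp add: algebra_simps)
qed simp

theorem theorem3p12:
  fixes A :: "('x::t2_space \<Rightarrow>\<^sub>C 'e::real_normed_vector) set"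
    and B :: "('y::t2_space \<Rightarrow>\<^sub>C 'f::real_normed_vector) set"
    and nA p :: "('x \<Rightarrow>\<^sub>C 'e) \<Rightarrow> real"
    and nB q :: "('y \<Rightarrow>\<^sub>C 'f) \<Rightarrow> real"
    and T :: "('x \<Rightarrow>\<^sub>C 'e) \<Rightarrow> ('y \<Rightarrow>\<^sub>C 'f)"
  assumes "compact (UNIV :: 'x set)" and "compact (UNIV :: 'y set)"
    and "property_Dw TYPE('f)"
    and "subspace A" and "range const_bcontfun \<subseteq> A" and "completely_regular A"
    and "subspace B" and "range const_bcontfun \<subseteq> B" and "separating B"
    and "seminorm_on A p" and "\<And>v. p (const_bcontfun v) = 0"
    and "seminorm_on B q" and "\<And>v. q (const_bcontfun v) = 0"
    and "\<And>f. f \<in> A \<Longrightarrow> nA f = max (norm f) (p f)"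
    and "\<And>g. g \<in> B \<Longrightarrow> nB g = max (norm g) (q g)"
    and "surj_linear_isometry A nA B nB T"
    and "property_St T" and "property_St (inv_into A T)"
  shows "\<exists>(\<phi> :: 'y \<Rightarrow> 'x) (V :: 'y \<Rightarrow> 'e \<Rightarrow>\<^sub>L 'f).
           continuous_on UNIV \<phi> \<and> surj \<phi> \<and>
           (\<forall>y. norm (V y) \<le> 1) \<and>
           (\<forall>y. \<forall>f\<in>A. apply_bcontfun (T f) y = blinfun_apply (V y) (apply_bcontfun f (\<phi> y))) \<and>
           (property_Dw TYPE('e) \<and> completely_regular B \<longrightarrow>
              (\<exists>\<psi>. homeomorphism UNIV UNIV \<phi> \<psi>) \<and>
              (\<forall>y. surj (blinfun_apply (V y)) \<and>
                   (\<forall>e. norm (blinfun_apply (V y) e) = norm e)))"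
proof -
  let ?S = "inv_into A T"
  have zero_B: "const_bcontfun 0 \<in> B"
    using assms(8) by blast
  then have nB0: "nB 0 = 0"
    using assms(13)[of 0] assms(15)[of 0] by simp
  have inj: "inj_on T A"
    using assms(14) by (intro surj_linear_isometry_inj_on[OF assms(16,4) _ nB0]) simp
  have inv: "surj_linear_isometry B nB A nA ?S"
    by (rule surj_linear_isometry_inverse[OF assms(16) inj assms(4)])
  have TB: "T ` A = B" and SA: "?S ` B = A"
    using assms(16) inv unfolding surj_linear_isometry_def by auto
  have ST: "?S (T f) = f" if "f \<in> A" for f
    using inj that by simp
  have TS: "T (?S g) = g" if "g \<in> B" for g
    using TB that by (simp add: f_inv_into_f)
  have le: "norm (T f) \<le> norm f" if "f \<in> A" for f
    by (rule norm_isometry_le[where A = A and B = B and p = p and q = q and nA = nA and nB = nB])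
      (fact assms that)+
  have ge: "norm (?S g) \<le> norm g" if "g \<in> B" for g
    by (rule norm_isometry_le[where A = B and B = A and p = q and q = p and nA = nB and nB = nA])
      (fact assms inv that)+
  (* Property (St) provides unit vectors, so neither E nor F is the zero space. *)
  have nontrivial: "\<exists>u::'e. u \<noteq> 0" "\<exists>u::'f. u \<noteq> 0"
    using assms(17,18) unfolding property_St_def by (metis mem_sphere_0 norm_zero zero_neq_one)+
  interpret sup_isometry A B T ?S
  proof unfold_locales
    show "norm (T f) = norm f" if "f \<in> A" for f
      using le[OF that] ge[of "T f"] ST[OF that] TB that by auto
  qed (use assms nontrivial TB SA ST TS in \<open>auto simp: surj_linear_isometry_def\<close>)
  interpret inv: sup_isometry B A ?S T
    by (rule inverse_isometry)
  obtain \<phi> where cont: "continuous_on UNIV \<phi>" and surj: "surj \<phi>"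
    and \<phi>: "\<forall>f\<in>A. \<forall>y. apply_bcontfun (T f) y = apply_bcontfun (T (const_bcontfun (apply_bcontfun f (\<phi> y)))) y"
    using weighted_composition[OF assms(6,9,3)] by blast
  define V where "V y = Blinfun (\<lambda>e. apply_bcontfun (T (const_bcontfun e)) y)" for y
  have V: "blinfun_apply (V y) e = apply_bcontfun (T (const_bcontfun e)) y" for y e
    unfolding V_def by (simp add: bounded_linear_Blinfun_apply bounded_linear_const_value)
  have norm_V: "norm (V y) \<le> 1" for y
  proof (rule norm_blinfun_bound)
    show "norm (blinfun_apply (V y) e) \<le> 1 * norm e" for e
      unfolding V using norm_bounded[of "T (const_bcontfun e)" y] norm_T[of "const_bcontfun e"] by simp
  qed simp
  have surj_V: "surj (blinfun_apply (V y))" for y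
    using const_values_surj[of \<phi> y] \<phi> unfolding V surj_def by metis
  have moreover_part: "(\<exists>\<psi>. homeomorphism UNIV UNIV \<phi> \<psi>) \<and> (\<forall>y e. norm (blinfun_apply (V y) e) = norm e)"
    if Dw: "property_Dw TYPE('e)" and reg: "completely_regular B"
  proof -
    have sepA: "separating A"
      using assms(6) by (rule completely_regular_imp_separating)
    obtain \<psi> where cont': "continuous_on UNIV \<psi>" and surj': "surj \<psi>"
      and \<psi>: "\<forall>g\<in>B. \<forall>x. apply_bcontfun (?S g) x = apply_bcontfun (?S (const_bcontfun (apply_bcontfun g (\<psi> x)))) x"
      using inv.weighted_composition[OF reg sepA Dw] by blast
    have "\<phi> (\<psi> x) = x" for x
      using point_maps_inverse[OF sepA \<phi> \<psi>] .
    moreover have "\<psi> (\<phi> y) = y" for y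
      using inv.point_maps_inverse[OF assms(9) \<psi> \<phi>] .
    ultimately have "homeomorphism UNIV UNIV \<phi> \<psi>"
      using cont cont' surj surj' by (auto simp: homeomorphism_def)
    moreover have "norm (blinfun_apply (V y) e) = norm e" for y e
    proof -
      obtain x where "y = \<psi> x"
        using surj' by blast
      then show ?thesis
        unfolding V using const_value_norm[OF \<psi>] by simp
    qed
    ultimately show ?thesis
      by blast
  qed
  show ?thesis
  proof (rule exI[of _ \<phi>], rule exI[of _ V], intro conjI allI ballI impI)
    show "apply_bcontfun (T f) y = blinfun_apply (V y) (apply_bcontfun f (\<phi> y))" if "f \<in> A" for f y
      unfolding V using \<phi> that by blast
  qed (use cont surj norm_V surj_V moreover_part in auto)
qed

end
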